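(* Let $\mathbb{F}$ be a field, let $R=\mathbb{F}[X_1,\ldots,X_n]$ be $\mathbb{Z}$-graded with $\deg(X_i)=d_i\geq 1$ for $i=1,\ldots,n$, and let $M$ be a finitely generated graded $R$-module. Then the Hilbert series of $M$ can be written in the form \[ H_M(t)=\sum_{I\subseteq\{1,\ldots,n\}}\frac{Q_I(t)}{\prod_{i\in I}\left(1-t^{d_i}\right)} \] with nonnegative $Q_I\in\mathbb{Z}[t,t^{-1}]$.
   Context: The Hilbert series of a finitely generated graded $R$-module $M=\bigoplus_{j\in\mathbb{Z}}M_j$ is the formal Laurent series $H_M(t)=\sum_{j\in\mathbb{Z}}(\dim_{\mathbb{F}}M_j)\,t^j\in\mathbb{Z}[\![t]\!][t^{-1}]$. A Laurent series or Laurent polynomial is called nonnegative if it has no negative coefficients. Each fraction $1/(1-t^{d})$ is expanded as $\sum_{k\ge 0}t^{kd}$. *)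

theory Defs
  imports
    "HOL-Library.Poly_Mapping"
    "HOL-Computational_Algebra.Formal_Laurent_Series"
    "Jordan_Normal_Form.VS_Connect"
begin

section \<open>Polynomial rings with weighted grading\<close>

text \<open>
  A monomial is an exponent vector of type \<^typ>\<open>nat \<Rightarrow>\<^sub>0 nat\<close>. The ring \<open>\<F>[X\<^sub>1, \<dots>, X\<^sub>n]\<close>
  consists of those finitely supported functions on monomials that only involve
  the variables with index in \<open>{1..n}\<close>; the case \<open>n = 0\<close> is included.
\<close>

definition poly_ring :: "nat \<Rightarrow> ((nat \<Rightarrow>\<^sub>0 nat) \<Rightarrow>\<^sub>0 'f::field) ring" where
  "poly_ring n =
    \<lparr>carrier = {p. \<forall>m \<in> Poly_Mapping.keys p. Poly_Mapping.keys m \<subseteq> {1..n}},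
     mult = (*), one = 1, zero = 0, add = (+)\<rparr>"

definition weighted_degree :: "nat \<Rightarrow> (nat \<Rightarrow> nat) \<Rightarrow> (nat \<Rightarrow>\<^sub>0 nat) \<Rightarrow> int" where
  "weighted_degree n d m = int (\<Sum>i=1..n. d i * Poly_Mapping.lookup m i)"

definition poly_homogeneous ::
    "nat \<Rightarrow> (nat \<Rightarrow> nat) \<Rightarrow> int \<Rightarrow> ((nat \<Rightarrow>\<^sub>0 nat) \<Rightarrow>\<^sub>0 'f::field) set" where
  "poly_homogeneous n d k =
    {p \<in> carrier (poly_ring n). \<forall>m \<in> Poly_Mapping.keys p. weighted_degree n d m = k}"

lemma cring_poly_ring: "cring (poly_ring n :: ((nat \<Rightarrow>\<^sub>0 nat) \<Rightarrow>\<^sub>0 'f::field) ring)"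
proof -
  let ?C = "carrier (poly_ring n :: ((nat \<Rightarrow>\<^sub>0 nat) \<Rightarrow>\<^sub>0 'f) ring)"
  have add: "p + q \<in> ?C" if "p \<in> ?C" "q \<in> ?C" for p q
  proof -
    have "Poly_Mapping.keys m \<subseteq> {1..n}" if "m \<in> Poly_Mapping.keys (p + q)" for m
    proof -
      from that Poly_Mapping.keys_add[of p q]
      have "m \<in> Poly_Mapping.keys p \<or> m \<in> Poly_Mapping.keys q" by blast
      with \<open>p \<in> ?C\<close> \<open>q \<in> ?C\<close> show ?thesis
        unfolding poly_ring_def by fastforce
    qed
    then show ?thesis by (simp add: poly_ring_def)
  qed
  have mult: "p * q \<in> ?C" if "p \<in> ?C" "q \<in> ?C" for p q
  proof -
    have "Poly_Mapping.keys m \<subseteq> {1..n}" if m: "m \<in> Poly_Mapping.keys (p * q)" for m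
    proof -
      from m Poly_Mapping.keys_mult[of p q] obtain a b
        where ab: "m = a + b" "a \<in> Poly_Mapping.keys p" "b \<in> Poly_Mapping.keys q" by blast
      from \<open>p \<in> ?C\<close> \<open>q \<in> ?C\<close> ab(2,3)
      have "Poly_Mapping.keys a \<subseteq> {1..n}" "Poly_Mapping.keys b \<subseteq> {1..n}"
        by (simp_all add: poly_ring_def)
      then show ?thesis
        using Poly_Mapping.keys_add[of a b] unfolding ab(1) by blast
    qed
    then show ?thesis by (simp add: poly_ring_def)
  qed
  have uminus: "- p \<in> ?C" if "p \<in> ?C" for p
    using that by (simp add: poly_ring_def)
  have zero: "0 \<in> ?C" and one: "1 \<in> ?C"
    by (simp_all add: poly_ring_def)
  have [simp]: "mult (poly_ring n) = ((*) :: _ \<Rightarrow> _ \<Rightarrow> (nat \<Rightarrow>\<^sub>0 nat) \<Rightarrow>\<^sub>0 'f)"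
    "add (poly_ring n) = ((+) :: _ \<Rightarrow> _ \<Rightarrow> (nat \<Rightarrow>\<^sub>0 nat) \<Rightarrow>\<^sub>0 'f)"
    "monoid.one (poly_ring n) = (1 :: (nat \<Rightarrow>\<^sub>0 nat) \<Rightarrow>\<^sub>0 'f)"
    "ring.zero (poly_ring n) = (0 :: (nat \<Rightarrow>\<^sub>0 nat) \<Rightarrow>\<^sub>0 'f)"
    by (simp_all add: poly_ring_def)
  show ?thesis
  proof (rule cringI)
    show "abelian_group (poly_ring n :: ((nat \<Rightarrow>\<^sub>0 nat) \<Rightarrow>\<^sub>0 'f) ring)"
    proof (rule abelian_groupI)
      fix p assume p: "p \<in> ?C"
      show "\<exists>q \<in> ?C. q \<oplus>\<^bsub>poly_ring n\<^esub> p = \<zero>\<^bsub>poly_ring n\<^esub>"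
        using uminus[OF p] by (intro bexI[of _ "- p"]) simp_all
    qed (simp_all add: add zero ac_simps)
    show "Group.comm_monoid (poly_ring n :: ((nat \<Rightarrow>\<^sub>0 nat) \<Rightarrow>\<^sub>0 'f) ring)"
      by (rule comm_monoidI) (simp_all add: mult one ac_simps)
  qed (simp add: distrib_right)
qed


section \<open>Graded modules and their Hilbert series\<close>

text \<open>
  \<open>G j\<close> is the homogeneous component \<open>M\<^sub>j\<close>. The direct sum decomposition \<open>M = \<Oplus>\<^sub>j M\<^sub>j\<close> is
  internal: every element is in a unique way a finitely supported sum of elements of the
  components.
\<close>

locale graded_poly_module = module "poly_ring n" M
  for n :: nat and M :: "((nat \<Rightarrow>\<^sub>0 nat) \<Rightarrow>\<^sub>0 'f::field, 'm) module" +
  fixes d :: "nat \<Rightarrow> nat" and G :: "int \<Rightarrow> 'm set"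
  assumes component_subgroup: "subgroup (G j) (add_monoid M)"
    and direct_decomposition:
      "x \<in> carrier M \<Longrightarrow>
        \<exists>!c. (\<forall>j. c j \<in> G j) \<and> finite {j. c j \<noteq> \<zero>\<^bsub>M\<^esub>} \<and> x = finsum M c {j. c j \<noteq> \<zero>\<^bsub>M\<^esub>}"
    and smult_homogeneous:
      "p \<in> poly_homogeneous n d i \<Longrightarrow> x \<in> G j \<Longrightarrow> p \<odot>\<^bsub>M\<^esub> x \<in> G (i + j)"

definition finitely_generated :: "('a, 'b) ring_scheme \<Rightarrow> ('a, 'm, 'c) module_scheme \<Rightarrow> bool" where
  "finitely_generated R M \<longleftrightarrow>
    (\<exists>S. finite S \<and> S \<subseteq> carrier M \<and> module.span R M S = carrier M)"

text \<open>
  The field acts on a homogeneous component through the constant polynomials, which are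
  \<open>Poly_Mapping.single 0 c\<close>. The \<open>mult\<close> and \<open>one\<close> fields of a module record carry no meaning.
\<close>

definition component_space ::
    "((nat \<Rightarrow>\<^sub>0 nat) \<Rightarrow>\<^sub>0 'f::field, 'm) module \<Rightarrow> 'm set \<Rightarrow> ('f, 'm) module" where
  "component_space M A =
    \<lparr>carrier = A, mult = mult M, one = monoid.one M, zero = ring.zero M, add = add M,
     smult = (\<lambda>c x. Poly_Mapping.single 0 c \<odot>\<^bsub>M\<^esub> x)\<rparr>"

lemma (in graded_poly_module) vectorspace_component:
  "vectorspace (class_ring :: 'f ring) (component_space M (G j))"
proof -
  interpret A: subgroup "G j" "add_monoid M" by (rule component_subgroup)
  have plus: "x \<oplus>\<^bsub>M\<^esub> y \<in> G j" if "x \<in> G j" "y \<in> G j" for x y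
    using A.m_closed that by simp
  have null: "\<zero>\<^bsub>M\<^esub> \<in> G j"
    using A.one_closed by simp
  have neg: "\<ominus>\<^bsub>M\<^esub> x \<in> G j" if "x \<in> G j" for x
    using A.m_inv_closed that by (simp add: a_inv_def)
  have sub: "x \<in> carrier M" if "x \<in> G j" for x
    using that A.subset by auto
  have field_const: "Poly_Mapping.single 0 c \<in> carrier (poly_ring n)"
    and homog: "Poly_Mapping.single 0 c \<in> poly_homogeneous n d 0" for c :: 'f
    by (auto simp: poly_ring_def poly_homogeneous_def weighted_degree_def split: if_splits)
  have closed: "Poly_Mapping.single 0 c \<odot>\<^bsub>M\<^esub> x \<in> G j" if "x \<in> G j" for c x
    using smult_homogeneous[OF homog that] by simp
  have ops: "add (poly_ring n) = ((+) :: _ \<Rightarrow> _ \<Rightarrow> (nat \<Rightarrow>\<^sub>0 nat) \<Rightarrow>\<^sub>0 'f)"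
    "mult (poly_ring n) = ((*) :: _ \<Rightarrow> _ \<Rightarrow> (nat \<Rightarrow>\<^sub>0 nat) \<Rightarrow>\<^sub>0 'f)"
    "monoid.one (poly_ring n) = (1 :: (nat \<Rightarrow>\<^sub>0 nat) \<Rightarrow>\<^sub>0 'f)"
    by (simp_all add: poly_ring_def)
  have "module (class_ring :: 'f ring) (component_space M (G j))"
  proof (rule moduleI)
    show "cring (class_ring :: 'f ring)" by (rule class_cring.is_cring)
    show "abelian_group (component_space M (G j))"
    proof (rule abelian_groupI; simp add: component_space_def)
      fix x assume x: "x \<in> G j"
      then show "\<exists>y \<in> G j. y \<oplus>\<^bsub>M\<^esub> x = \<zero>\<^bsub>M\<^esub>"
        using neg sub by (intro bexI[of _ "\<ominus>\<^bsub>M\<^esub> x"]) (auto intro: M.l_neg)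
    qed (auto simp: sub plus null M.a_ac)
  next
    fix a b :: 'f and x
    assume x: "x \<in> carrier (component_space M (G j))"
    then have x': "x \<in> carrier M" by (simp add: component_space_def sub)
    show "(a \<oplus>\<^bsub>class_ring\<^esub> b) \<odot>\<^bsub>component_space M (G j)\<^esub> x =
      a \<odot>\<^bsub>component_space M (G j)\<^esub> x \<oplus>\<^bsub>component_space M (G j)\<^esub> b \<odot>\<^bsub>component_space M (G j)\<^esub> x"
      using smult_l_distr[OF field_const[of a] field_const[of b] x']
      by (simp add: component_space_def ops single_add)
    show "(a \<otimes>\<^bsub>class_ring\<^esub> b) \<odot>\<^bsub>component_space M (G j)\<^esub> x =
      a \<odot>\<^bsub>component_space M (G j)\<^esub> (b \<odot>\<^bsub>component_space M (G j)\<^esub> x)"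
      using smult_assoc1[OF field_const[of a] field_const[of b] x']
      by (simp add: component_space_def ops mult_single)
    show "\<one>\<^bsub>class_ring\<^esub> \<odot>\<^bsub>component_space M (G j)\<^esub> x = x"
      using smult_one[OF x'] by (simp add: component_space_def ops)
  qed (auto simp: component_space_def closed sub field_const smult_r_distr)
  then show ?thesis
    by (intro vectorspace.intro) (auto intro: class_field.field_axioms)
qed

definition hilbert_series ::
    "((nat \<Rightarrow>\<^sub>0 nat) \<Rightarrow>\<^sub>0 'f::field, 'm) module \<Rightarrow> (int \<Rightarrow> 'm set) \<Rightarrow> int fls" where
  "hilbert_series M G =
    Abs_fls (\<lambda>j. int (vectorspace.dim (class_ring :: 'f ring) (component_space M (G j))))"


section \<open>Laurent polynomials and geometric series\<close>

definition laurent_polynomial :: "int fls \<Rightarrow> bool" where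
  "laurent_polynomial f \<longleftrightarrow> finite {k. fls_nth f k \<noteq> 0}"

definition nonnegative :: "int fls \<Rightarrow> bool" where
  "nonnegative f \<longleftrightarrow> (\<forall>k. fls_nth f k \<ge> 0)"

text \<open>The expansion \<open>\<Sum>\<^sub>k t\<^bsup>k e\<^esup>\<close> of \<open>1 / (1 - t\<^sup>e)\<close>, for \<open>e \<ge> 1\<close>.\<close>

definition geometric_fls :: "nat \<Rightarrow> int fls" where
  "geometric_fls e = fps_to_fls (Abs_fps (\<lambda>m. if e dvd m then 1 else 0))"

lemma geometric_fls_inverse:
  assumes "e \<ge> 1"
  shows "geometric_fls e * (1 - fls_X ^ e) = 1"
proof -
  define g :: "int fps" where "g = Abs_fps (\<lambda>m. if e dvd m then 1 else 0)"
  have "g * (1 - fps_X ^ e) = 1"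
  proof (rule fps_ext)
    fix m
    show "fps_nth (g * (1 - fps_X ^ e)) m = fps_nth (1 :: int fps) m"
      using assms
      by (auto simp: g_def right_diff_distrib fps_X_power_mult_right_nth dvd_minus_self
          dest: dvd_imp_le)
  qed
  then have "fps_to_fls g * (1 - fps_to_fls fps_X ^ e) = 1"
    by (metis fls_times_fps_to_fls fps_one_to_fls fps_to_fls_minus fps_to_fls_power)
  then show ?thesis by (simp add: geometric_fls_def g_def)
qed

end

theory Submission
  imports Defs "HOL-Library.Product_Lexorder"
begin

text \<open>
  Let \<open>g\<^sub>1, \<dots>, g\<^sub>r\<close> be homogeneous generators of \<open>M\<close>. The products \<open>x\<^sup>a g\<^sub>i\<close> of a fixed degree are
  finitely many and span the component; call \<open>x\<^sup>a g\<^sub>i\<close> standard if it is not a linear combination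
  of smaller ones of the same degree, for an order on the pairs \<open>(a, i)\<close> that is compatible with the
  addition of exponents. The standard products of degree \<open>j\<close> are a basis of \<open>M\<^sub>j\<close>, and for each \<open>i\<close> the
  standard exponents form a lower set, since a linear dependence can be multiplied by a monomial. So it
  suffices to treat the generating series of a lower set \<open>D\<close> of exponents. Slicing \<open>D\<close> by the exponent
  of one variable gives a decreasing chain of lower sets in the other variables, which stabilizes by
  Dickson's lemma: the finitely many slices before that point contribute shifted copies of their
  series, and the constant tail contributes a geometric series.
\<close>


section \<open>Nonnegative combinations of products of geometric series\<close>

text \<open>The index set \<open>I\<close> is a parameter so that variables can be adjoined one at a
  time; for \<open>I = {1..n}\<close> this is the conclusion of the theorem.\<close>

definition geometric_combination :: "(nat \<Rightarrow> nat) \<Rightarrow> nat set \<Rightarrow> int fls \<Rightarrow> bool" where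
  "geometric_combination d I f \<longleftrightarrow>
    (\<exists>Q. (\<forall>J\<subseteq>I. laurent_polynomial (Q J) \<and> nonnegative (Q J)) \<and>
      f = (\<Sum>J\<in>Pow I. Q J * (\<Prod>j\<in>J. geometric_fls (d j))))"

lemma laurent_polynomial_0: "laurent_polynomial 0"
  and laurent_polynomial_1: "laurent_polynomial 1"
  and laurent_polynomial_add:
    "laurent_polynomial f \<Longrightarrow> laurent_polynomial g \<Longrightarrow> laurent_polynomial (f + g)"
  and laurent_polynomial_shift:
    "laurent_polynomial f \<Longrightarrow> laurent_polynomial (fls_X_intpow k * f)"
proof -
  show "laurent_polynomial 0" by (simp add: laurent_polynomial_def)
  show "laurent_polynomial 1" by (simp add: laurent_polynomial_def)
  show "laurent_polynomial (f + g)" if "laurent_polynomial f" "laurent_polynomial g"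
  proof -
    have "{k. fls_nth (f + g) k \<noteq> 0} \<subseteq> {k. fls_nth f k \<noteq> 0} \<union> {k. fls_nth g k \<noteq> 0}"
      by auto
    with that show ?thesis
      unfolding laurent_polynomial_def by (meson finite_UnI finite_subset)
  qed
  show "laurent_polynomial (fls_X_intpow k * f)" if "laurent_polynomial f"
  proof -
    have "{j. fls_nth (fls_X_intpow k * f) j \<noteq> 0} = (+) k ` {j. fls_nth f j \<noteq> 0}"
      by (auto simp: fls_X_intpow_times_conv_shift image_iff intro!: exI[of _ "_ - k"])
    then show ?thesis using that by (simp add: laurent_polynomial_def)
  qed
qed

lemma nonnegative_0: "nonnegative 0"
  and nonnegative_1: "nonnegative 1"
  and nonnegative_add: "nonnegative f \<Longrightarrow> nonnegative g \<Longrightarrow> nonnegative (f + g)"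
  and nonnegative_shift: "nonnegative f \<Longrightarrow> nonnegative (fls_X_intpow k * f)"
  by (auto simp: nonnegative_def fls_X_intpow_times_conv_shift)

lemma geometric_combination_0: "geometric_combination d I 0"
  unfolding geometric_combination_def
  by (intro exI[of _ "\<lambda>_. 0"]) (simp add: laurent_polynomial_0 nonnegative_0)

lemma geometric_combination_empty_1: "geometric_combination d {} 1"
  unfolding geometric_combination_def
  by (intro exI[of _ "\<lambda>_. 1"]) (simp add: laurent_polynomial_1 nonnegative_1)

lemma geometric_combination_add:
  assumes "geometric_combination d I f" "geometric_combination d I g"
  shows "geometric_combination d I (f + g)"
proof -
  obtain P Q where
    "\<forall>J\<subseteq>I. laurent_polynomial (P J) \<and> nonnegative (P J)"
    "f = (\<Sum>J\<in>Pow I. P J * (\<Prod>j\<in>J. geometric_fls (d j)))"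
    "\<forall>J\<subseteq>I. laurent_polynomial (Q J) \<and> nonnegative (Q J)"
    "g = (\<Sum>J\<in>Pow I. Q J * (\<Prod>j\<in>J. geometric_fls (d j)))"
    using assms unfolding geometric_combination_def by blast
  then show ?thesis unfolding geometric_combination_def
    by (intro exI[of _ "\<lambda>J. P J + Q J"])
      (simp add: laurent_polynomial_add nonnegative_add distrib_right sum.distrib)
qed

lemma geometric_combination_sum:
  assumes "\<And>x. x \<in> A \<Longrightarrow> geometric_combination d I (f x)"
  shows "geometric_combination d I (sum f A)"
  using assms
  by (induction A rule: infinite_finite_induct)
    (auto simp: geometric_combination_0 geometric_combination_add)

lemma geometric_combination_shift:
  assumes "geometric_combination d I f"
  shows "geometric_combination d I (fls_X_intpow k * f)"
proof -
  obtain Q where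
    "\<forall>J\<subseteq>I. laurent_polynomial (Q J) \<and> nonnegative (Q J)"
    "f = (\<Sum>J\<in>Pow I. Q J * (\<Prod>j\<in>J. geometric_fls (d j)))"
    using assms unfolding geometric_combination_def by blast
  then show ?thesis unfolding geometric_combination_def
    by (intro exI[of _ "\<lambda>J. fls_X_intpow k * Q J"])
      (simp add: laurent_polynomial_shift nonnegative_shift sum_distrib_left mult.assoc)
qed

text \<open>The subsets of \<open>insert i I\<close> are the subsets \<open>J\<close> of
  \<open>I\<close> and the sets \<open>insert i J\<close>. In the first claim the coefficient of
  \<open>J\<close> stays at \<open>J\<close>; in the second it moves to \<open>insert i J\<close>,
  whose product has the additional factor \<open>geometric_fls (d i)\<close>.\<close>

lemma geometric_combination_insert:
  assumes "finite I" "i \<notin> I" "geometric_combination d I f"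
  shows "geometric_combination d (insert i I) f"
    and "geometric_combination d (insert i I) (geometric_fls (d i) * f)"
proof -
  obtain Q where Q: "\<forall>J\<subseteq>I. laurent_polynomial (Q J) \<and> nonnegative (Q J)"
    and f: "f = (\<Sum>J\<in>Pow I. Q J * (\<Prod>j\<in>J. geometric_fls (d j)))"
    using assms(3) unfolding geometric_combination_def by blast
  have disj: "Pow I \<inter> insert i ` Pow I = {}" and inj: "inj_on (insert i) (Pow I)"
    using assms(2) by (auto intro!: inj_onI)
  have split: "(\<Sum>J\<in>Pow (insert i I). g J) =
      (\<Sum>J\<in>Pow I. g J) + (\<Sum>J\<in>Pow I. g (insert i J))" for g :: "nat set \<Rightarrow> int fls"
    unfolding Pow_insert using assms(1) disj inj
    by (simp add: sum.union_disjoint sum.reindex)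
  show "geometric_combination d (insert i I) f"
    unfolding geometric_combination_def
  proof (intro exI[of _ "\<lambda>J. if i \<in> J then 0 else Q J"] conjI allI impI)
    show "f = (\<Sum>J\<in>Pow (insert i I). (if i \<in> J then 0 else Q J) * (\<Prod>j\<in>J. geometric_fls (d j)))"
      unfolding split f using assms(2) by (auto intro!: sum.cong)
  qed (use Q in \<open>auto simp: laurent_polynomial_0 nonnegative_0\<close>)
  show "geometric_combination d (insert i I) (geometric_fls (d i) * f)"
    unfolding geometric_combination_def
  proof (intro exI[of _ "\<lambda>J. if i \<in> J then Q (J - {i}) else 0"] conjI allI impI)
    have "(if i \<in> insert i J then Q (insert i J - {i}) else 0) *
        (\<Prod>j\<in>insert i J. geometric_fls (d j)) =
        geometric_fls (d i) * (Q J * (\<Prod>j\<in>J. geometric_fls (d j)))" if "J \<in> Pow I" for J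
    proof -
      have "i \<notin> J" "finite J" using that assms by (auto intro: finite_subset)
      then show ?thesis by (simp add: mult.left_commute)
    qed
    then show "geometric_fls (d i) * f = (\<Sum>J\<in>Pow (insert i I).
        (if i \<in> J then Q (J - {i}) else 0) * (\<Prod>j\<in>J. geometric_fls (d j)))"
      unfolding split f using assms(2)
      by (simp add: sum_distrib_left, intro sum.neutral) auto
  qed (use Q in \<open>auto simp: laurent_polynomial_0 nonnegative_0 subset_insert_iff\<close>)
qed


section \<open>Lower sets of exponents\<close>

definition exponents :: "nat set \<Rightarrow> (nat \<Rightarrow>\<^sub>0 nat) set" where
  "exponents I = {a. Poly_Mapping.keys a \<subseteq> I}"

text \<open>Addition of exponents is multiplication of monomials, so this is closure under divisors:
  the complement is the exponent set of a monomial ideal.\<close>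

definition lower_set :: "(nat \<Rightarrow>\<^sub>0 nat) set \<Rightarrow> bool" where
  "lower_set D \<longleftrightarrow> (\<forall>a c. a + c \<in> D \<longrightarrow> a \<in> D)"

lemma lower_setD: "lower_set D \<Longrightarrow> a + c \<in> D \<Longrightarrow> a \<in> D"
  by (auto simp: lower_set_def)

lemma keys_plus_nat: "Poly_Mapping.keys (a + b :: nat \<Rightarrow>\<^sub>0 nat) = Poly_Mapping.keys a \<union> Poly_Mapping.keys b"
  by (auto simp: in_keys_iff lookup_add)

lemma exponents_plus_iff: "a + b \<in> exponents I \<longleftrightarrow> a \<in> exponents I \<and> b \<in> exponents I"
  by (simp add: exponents_def keys_plus_nat)

section \<open>Dickson's lemma by monotone subsequences\<close>

lemma nat_seq_mono_subseq:
  fixes s :: "nat \<Rightarrow> nat"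
  shows "\<exists>r :: nat \<Rightarrow> nat. strict_mono r \<and> mono (\<lambda>k. s (r k))"
proof -
  obtain f where f: "strict_mono f" and m: "monoseq (\<lambda>n. s (f n))"
    using seq_monosub[of s] by blast
  from m consider "mono (\<lambda>n. s (f n))" | "decseq (\<lambda>n. s (f n))"
    unfolding monoseq_iff by blast
  then show ?thesis
  proof cases
    case 1
    with f show ?thesis by blast
  next
    case 2
    \<comment> \<open>A decreasing sequence of naturals is constant, hence monotone, from the place
      where it attains its minimum.\<close>
    obtain N where N: "\<And>n. s (f N) \<le> s (f n)"
      using ex_has_least_nat[of "\<lambda>_. True" _ "\<lambda>n. s (f n)"] by blast
    have "s (f (n + N)) = s (f N)" for n
      using N[of "n + N"] decseqD[OF 2, of N "n + N"] by simp
    moreover have "strict_mono (\<lambda>n. f (n + N))"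
      using f by (simp add: strict_mono_def)
    ultimately show ?thesis by (intro exI[of _ "\<lambda>n. f (n + N)"]) (simp add: mono_def)
  qed
qed

text \<open>Induction on the coordinates: each new one is made monotone by a further subsequence,
  which keeps the earlier ones monotone.\<close>

lemma finite_mono_subseq:
  fixes x :: "nat \<Rightarrow> 'i \<Rightarrow> nat"
  assumes "finite I"
  shows "\<exists>r :: nat \<Rightarrow> nat. strict_mono r \<and> (\<forall>i\<in>I. mono (\<lambda>k. x (r k) i))"
  using assms
proof induction
  case empty
  show ?case by (auto intro: strict_mono_id)
next
  case (insert i I)
  then obtain r :: "nat \<Rightarrow> nat" where r: "strict_mono r" "\<forall>i\<in>I. mono (\<lambda>k. x (r k) i)" by blast
  obtain q :: "nat \<Rightarrow> nat" where q: "strict_mono q" "mono (\<lambda>k. x (r (q k)) i)"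
    using nat_seq_mono_subseq[of "\<lambda>k. x (r k) i"] by blast
  have "mono (\<lambda>k. x (r (q k)) j)" if "j \<in> I" for j
    using r(2) that strict_mono_mono[OF q(1)] unfolding mono_def by blast
  with r q show ?case
    by (intro exI[of _ "\<lambda>k. r (q k)"]) (auto simp: strict_mono_def)
qed

text \<open>Otherwise every step loses some exponent \<open>x k\<close>. By Dickson's lemma an
  earlier one \<open>x (r 0)\<close> divides a later one \<open>x (r 1)\<close>; the latter still
  lies in \<open>C (Suc (r 0))\<close>, so this lower set contains \<open>x (r 0)\<close>, which it
  has lost.\<close>

lemma lower_set_chain_stops:
  assumes "finite I" and sub: "\<And>k. C k \<subseteq> exponents I" and lower: "\<And>k. lower_set (C k)"
    and decr: "\<And>k. C (Suc k) \<subseteq> C k"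
  shows "\<exists>k. C (Suc k) = C k"
proof (rule ccontr)
  assume "\<not> ?thesis"
  with decr have "\<forall>k. \<exists>x. x \<in> C k - C (Suc k)" by blast
  then obtain x where x: "\<And>k. x k \<in> C k - C (Suc k)" by metis
  obtain r :: "nat \<Rightarrow> nat" where r: "strict_mono r" "\<forall>i\<in>I. mono (\<lambda>k. Poly_Mapping.lookup (x (r k)) i)"
    using finite_mono_subseq[OF assms(1), of "\<lambda>k. Poly_Mapping.lookup (x k)"] by blast
  have le: "Poly_Mapping.lookup (x (r 0)) i \<le> Poly_Mapping.lookup (x (r 1)) i" for i
  proof (cases "i \<in> I")
    case True
    with r(2) show ?thesis by (auto simp: mono_def)
  next
    case False
    then have "i \<notin> Poly_Mapping.keys (x (r 0))"
      using x[of "r 0"] sub[of "r 0"] by (auto simp: exponents_def)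
    then show ?thesis by (simp add: in_keys_iff)
  qed
  \<comment> \<open>Subtraction of exponents is truncated; \<open>le\<close> makes it exact.\<close>
  have "x (r 1) = x (r 0) + (x (r 1) - x (r 0))"
    by (rule poly_mapping_eqI) (use le in \<open>simp add: lookup_add lookup_minus\<close>)
  moreover have "r 0 < r 1" using r(1) by (simp add: strict_mono_def)
  then have "x (r 1) \<in> C (Suc (r 0))"
    using x[of "r 1"] lift_Suc_antimono_le[of C "Suc (r 0)" "r 1"] decr by auto
  ultimately have "x (r 0) \<in> C (Suc (r 0))"
    using lower_setD[OF lower] by metis
  with x show False by blast
qed


section \<open>Generating series of sets of exponents\<close>

text \<open>The set \<open>V\<close> is that of all variables and stays fixed while the set of
  variables in use varies, so that degrees do not change during the induction.\<close>

definition weight :: "(nat \<Rightarrow> nat) \<Rightarrow> nat set \<Rightarrow> (nat \<Rightarrow>\<^sub>0 nat) \<Rightarrow> nat" where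
  "weight d V a = (\<Sum>i\<in>V. d i * Poly_Mapping.lookup a i)"

definition exponent_series :: "(nat \<Rightarrow> nat) \<Rightarrow> nat set \<Rightarrow> (nat \<Rightarrow>\<^sub>0 nat) set \<Rightarrow> int fls" where
  "exponent_series d V A = fps_to_fls (Abs_fps (\<lambda>m. int (card {a \<in> A. weight d V a = m})))"

lemma weight_add: "weight d V (a + b) = weight d V a + weight d V b"
  by (simp add: weight_def lookup_add distrib_left sum.distrib)

lemma exponent_series_nth:
  "fls_nth (exponent_series d V A) k = int (card {a \<in> A. int (weight d V a) = k})"
proof (cases "k < 0")
  case True
  then have "{a \<in> A. int (weight d V a) = k} = {}" by auto
  with True show ?thesis by (simp add: exponent_series_def)
next
  case False
  then have "{a \<in> A. int (weight d V a) = k} = {a \<in> A. weight d V a = nat k}" by auto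
  with False show ?thesis by (simp add: exponent_series_def)
qed

text \<open>Since every \<open>d i\<close> is positive, each exponent is bounded by the total
  weight. This makes the cardinalities in \<open>exponent_series\<close> genuine counts.\<close>

lemma finite_exponents_weight:
  assumes "finite V" "\<And>i. i \<in> V \<Longrightarrow> d i \<ge> 1"
  shows "finite {a \<in> exponents V. weight d V a = m}"
proof (rule finite_imageD)
  have "Poly_Mapping.lookup a i \<le> weight d V a" if "i \<in> V" for a i
  proof -
    have "Poly_Mapping.lookup a i \<le> d i * Poly_Mapping.lookup a i"
      using assms(2)[OF that] by simp
    also have "\<dots> \<le> weight d V a"
      unfolding weight_def by (rule member_le_sum) (use assms that in auto)
    finally show ?thesis .
  qed
  then have "Poly_Mapping.lookup ` {a \<in> exponents V. weight d V a = m} \<subseteq>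
      {f. \<forall>i. (i \<in> V \<longrightarrow> f i \<in> {..m}) \<and> (i \<notin> V \<longrightarrow> f i = 0)}"
    by (auto simp: exponents_def in_keys_iff)
  then show "finite (Poly_Mapping.lookup ` {a \<in> exponents V. weight d V a = m})"
    by (rule finite_subset) (rule finite_set_of_finite_funs, use assms in auto)
  show "inj_on Poly_Mapping.lookup {a \<in> exponents V. weight d V a = m}"
    by (simp add: inj_on_def poly_mapping.lookup_inject)
qed

lemma exponent_series_Un:
  assumes "finite V" "\<And>i. i \<in> V \<Longrightarrow> d i \<ge> 1"
    and "A \<subseteq> exponents V" "B \<subseteq> exponents V" "A \<inter> B = {}"
  shows "exponent_series d V (A \<union> B) = exponent_series d V A + exponent_series d V B"
proof (rule fls_eqI)
  fix k
  have fin: "finite {a \<in> C. int (weight d V a) = k}" if "C \<subseteq> exponents V" for C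
    by (rule finite_subset[OF _ finite_exponents_weight[of V d "nat k", OF assms(1,2)]])
      (use that in auto)
  have "{a \<in> A \<union> B. int (weight d V a) = k} =
      {a \<in> A. int (weight d V a) = k} \<union> {a \<in> B. int (weight d V a) = k}" by auto
  then show "fls_nth (exponent_series d V (A \<union> B)) k =
      fls_nth (exponent_series d V A + exponent_series d V B) k"
    using fin[OF assms(3)] fin[OF assms(4)] assms(5)
    by (simp add: exponent_series_nth, subst card_Un_disjoint) auto
qed

lemma exponent_series_translate:
  "exponent_series d V ((+) c ` A) = fls_X_intpow (int (weight d V c)) * exponent_series d V A"
proof (rule fls_eqI)
  fix k
  have "{a \<in> (+) c ` A. int (weight d V a) = k} =
      (+) c ` {a \<in> A. int (weight d V a) = k - int (weight d V c)}"
    by (auto simp: weight_add)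
  then show "fls_nth (exponent_series d V ((+) c ` A)) k =
      fls_nth (fls_X_intpow (int (weight d V c)) * exponent_series d V A) k"
    by (simp add: exponent_series_nth fls_X_intpow_times_conv_shift card_image)
qed

text \<open>Induction on \<open>I\<close>. For a new variable \<open>i\<close>, a lower set
  \<open>C k\<close> is the disjoint union of its slice at \<open>i\<close>-th exponent
  \<open>0\<close>, covered by the induction hypothesis, and a translate of
  \<open>C (Suc k)\<close>. At a \<open>K\<close> where the chain stops this is a linear equation
  for the series of \<open>C K\<close>; from there one descends to \<open>C 0 = D\<close>.\<close>

lemma lower_set_geometric_combination:
  assumes V: "finite V" "\<And>i. i \<in> V \<Longrightarrow> d i \<ge> 1"
    and "I \<subseteq> V" "D \<subseteq> exponents I" "lower_set D"
  shows "geometric_combination d I (exponent_series d V D)"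
proof -
  have "finite I" using V(1) \<open>I \<subseteq> V\<close> finite_subset by blast
  then show ?thesis using assms(3-5)
  proof (induction I arbitrary: D)
    case empty
    then have D: "D = {} \<or> D = {0}" by (auto simp: exponents_def)
    have "exponent_series d V {} = 0"
      by (rule fls_eqI) (simp add: exponent_series_nth)
    moreover have "exponent_series d V {0} = 1"
    proof (rule fls_eqI)
      fix k
      have "{a \<in> {0 :: nat \<Rightarrow>\<^sub>0 nat}. int (weight d V a) = k} = (if k = 0 then {0} else {})"
        by (auto simp: weight_def)
      then show "fls_nth (exponent_series d V {0}) k = fls_nth 1 k"
        by (simp add: exponent_series_nth)
    qed
    ultimately show ?case
      using D geometric_combination_0 geometric_combination_empty_1 by metis
  next
    case (insert i I)
    define e where "e = Poly_Mapping.single i (1 :: nat)"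
    \<comment> \<open>The part of \<open>D\<close> with \<open>i\<close>-th exponent at least \<open>k\<close>, moved down by \<open>k\<close>: its slice at \<open>i\<close>-th
      exponent \<open>0\<close> is the complement of the translate of the next set.\<close>
    define C where "C k = {b. b + Poly_Mapping.single i k \<in> D}" for k
    have i: "i \<in> V" and expo: "exponents (insert i I) \<subseteq> exponents V"
      using insert.prems by (auto simp: exponents_def)
    have w: "weight d V e = d i"
      using V(1) i by (simp add: weight_def e_def lookup_single when_def if_distrib cong: if_cong)
    have C_Suc: "b + e \<in> C k \<longleftrightarrow> b \<in> C (Suc k)" for b k
      by (simp add: C_def e_def add.assoc flip: single_add)
    have C_sub: "C k \<subseteq> exponents (insert i I)" for k
      using insert.prems(2) by (auto simp: C_def exponents_plus_iff)
    have C_lower: "lower_set (C k)" for k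
      using insert.prems(3) unfolding lower_set_def C_def mem_Collect_eq
      by (metis add.assoc add.commute)
    have C_decr: "C (Suc k) \<subseteq> C k" for k
      using C_Suc lower_setD[OF C_lower] by blast
    have shift_sub: "(+) e ` C (Suc k) \<subseteq> C k" for k
      using C_Suc by (auto simp: add.commute)
    have base: "C k - (+) e ` C (Suc k) = {b \<in> C k. Poly_Mapping.lookup b i = 0}" for k
    proof -
      have "b \<in> (+) e ` C (Suc k) \<longleftrightarrow> Poly_Mapping.lookup b i \<noteq> 0" if "b \<in> C k" for b
      proof
        assume "Poly_Mapping.lookup b i \<noteq> 0"
        \<comment> \<open>The truncated subtraction is exact because the \<open>i\<close>-th
          exponent is positive.\<close>
        then have "b = e + (b - e)"
          by (intro poly_mapping_eqI) (auto simp: e_def lookup_add lookup_minus lookup_single when_def)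
        with that show "b \<in> (+) e ` C (Suc k)"
          using C_Suc[of "b - e" k] by (metis add.commute imageI)
      qed (auto simp: e_def lookup_add)
      then show ?thesis by blast
    qed
    have base_gc: "geometric_combination d I (exponent_series d V (C k - (+) e ` C (Suc k)))" for k
      unfolding base
    proof (rule insert.IH)
      show "{b \<in> C k. Poly_Mapping.lookup b i = 0} \<subseteq> exponents I"
      proof
        fix b assume "b \<in> {b \<in> C k. Poly_Mapping.lookup b i = 0}"
        then have "b \<in> exponents (insert i I)" "i \<notin> Poly_Mapping.keys b"
          using C_sub[of k] by (auto simp: in_keys_iff)
        then show "b \<in> exponents I" unfolding exponents_def by blast
      qed
      show "lower_set {b \<in> C k. Poly_Mapping.lookup b i = 0}"
        unfolding lower_set_def using lower_setD[OF C_lower[of k]] by (auto simp: lookup_add)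
    qed (use insert.prems in auto)
    have split: "exponent_series d V (C k) = exponent_series d V (C k - (+) e ` C (Suc k)) +
        fls_X_intpow (int (d i)) * exponent_series d V (C (Suc k))" for k
    proof -
      have "exponent_series d V (C k - (+) e ` C (Suc k) \<union> (+) e ` C (Suc k)) =
        exponent_series d V (C k - (+) e ` C (Suc k)) + exponent_series d V ((+) e ` C (Suc k))"
        by (rule exponent_series_Un) (use V C_sub[of k] shift_sub[of k] expo in auto)
      then show ?thesis
        using shift_sub[of k] by (simp add: exponent_series_translate w Un_absorb2)
    qed
    obtain K where K: "C (Suc K) = C K"
      using lower_set_chain_stops[of "insert i I" C] C_sub C_lower C_decr insert.hyps(1) by auto
    have "geometric_combination d (insert i I) (exponent_series d V (C K))"
    proof -
      let ?f = "exponent_series d V (C K)" and ?g = "exponent_series d V (C K - (+) e ` C (Suc K))"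
      have "?f = ?g + fls_X ^ d i * ?f"
        using split[of K] unfolding K fls_X_power_conv_shift_1 .
      then have "(1 - fls_X ^ d i) * ?f = ?g"
        unfolding left_diff_distrib mult_1 by (metis add_diff_cancel_right')
      then have "?f = geometric_fls (d i) * ?g"
        using geometric_fls_inverse[OF V(2)[OF i]] by (metis mult.assoc mult_1)
      then show ?thesis
        using geometric_combination_insert(2)[OF insert.hyps(1,2) base_gc] by simp
    qed
    \<comment> \<open>Downward induction from \<open>K\<close> to \<open>0\<close>. Only sums and
      shifts occur, so nonnegativity is preserved.\<close>
    then have "geometric_combination d (insert i I) (exponent_series d V (C 0))"
    proof (rule inc_induct[of 0 K, rotated])
      fix k assume "geometric_combination d (insert i I) (exponent_series d V (C (Suc k)))"
      then show "geometric_combination d (insert i I) (exponent_series d V (C k))"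
        unfolding split[of k]
        by (intro geometric_combination_add geometric_combination_shift
            geometric_combination_insert(1)[OF insert.hyps(1,2) base_gc])
    qed simp
    then show ?case by (simp add: C_def)
  qed
qed


section \<open>Pivots of a spanning family\<close>

lemma (in vectorspace) span_insert_absorb:
  assumes "A \<subseteq> carrier V" "x \<in> span A"
  shows "span (insert x A) = span A"
proof
  show "span (insert x A) \<subseteq> span A"
    using assms in_own_span[of A] span_is_submodule[of A] by (intro span_is_subset) auto
  show "span A \<subseteq> span (insert x A)"
    by (rule span_is_monotone) auto
qed

lemma (in vectorspace) span_insert_cong:
  assumes "A \<subseteq> carrier V" "B \<subseteq> carrier V" "x \<in> carrier V" "span A = span B"
  shows "span (insert x A) = span (insert x B)"
proof -
  have "span (insert x A) \<subseteq> span (insert x B)"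
    if "A \<subseteq> carrier V" "B \<subseteq> carrier V" "span A = span B" for A B
  proof (rule span_is_subset)
    have "x \<in> span (insert x B)"
      using in_own_span[of "insert x B"] that assms(3) by auto
    moreover have "A \<subseteq> span (insert x B)"
      using in_own_span[of A] span_is_monotone[of B "insert x B"] that by auto
    ultimately show "insert x A \<subseteq> span (insert x B)" by simp
    show "LinearCombinations.submodule K (span (insert x B)) V"
      using that assms(3) by (intro span_is_submodule) auto
  qed
  from this[of A B] this[of B A] assms show ?thesis by auto
qed

text \<open>The greedy choice, as for pivot columns in row reduction. It collects indices, not
  vectors, since \<open>v\<close> may repeat values; a repeated vector is not a pivot again.\<close>

definition (in vectorspace) pivots :: "('i::linorder \<Rightarrow> 'c) \<Rightarrow> 'i set \<Rightarrow> 'i set" where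
  "pivots v T = {t \<in> T. v t \<notin> span (v ` {s \<in> T. s < t})}"

text \<open>Induction by adjoining a largest index \<open>m\<close>: earlier pivots are unaffected,
  since only smaller indices matter to them, and \<open>m\<close> becomes a pivot exactly when
  \<open>v m\<close> enlarges the span.\<close>

lemma (in vectorspace) pivots_basis:
  fixes v :: "'i::linorder \<Rightarrow> 'c"
  assumes "finite T" "v ` T \<subseteq> carrier V"
  shows "inj_on v (pivots v T) \<and> lin_indpt (v ` pivots v T) \<and>
    span (v ` pivots v T) = span (v ` T)"
  using assms
proof (induction T rule: finite_linorder_max_induct)
  case empty
  have "lin_indpt {}" by (rule finite_lin_indpt2) auto
  then show ?case by (simp add: pivots_def)
next
  case (insert m T)
  let ?P = "pivots v T"
  have IH: "inj_on v ?P" "lin_indpt (v ` ?P)" "span (v ` ?P) = span (v ` T)"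
    using insert by auto
  have sub: "v ` T \<subseteq> carrier V" "v m \<in> carrier V" "v ` ?P \<subseteq> carrier V"
    using insert.prems by (auto simp: pivots_def)
  have "{s \<in> insert m T. s < t} = {s \<in> T. s < t}" if "t \<in> T" for t
    using that insert.hyps(2) by force
  moreover have "{s \<in> insert m T. s < m} = T" using insert.hyps(2) by auto
  moreover have "m \<notin> T" using insert.hyps(2) by auto
  ultimately have piv: "pivots v (insert m T) = (if v m \<in> span (v ` T) then ?P else insert m ?P)"
    unfolding pivots_def by auto
  show ?case
  proof (cases "v m \<in> span (v ` T)")
    case True
    then show ?thesis using piv IH span_insert_absorb[OF sub(1)] by simp
  next
    case False
    then have new: "v m \<notin> v ` ?P" "v m \<notin> span (v ` ?P)"
      using IH(3) in_own_span[OF sub(3)] by auto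
    then have "lin_indpt (insert (v m) (v ` ?P))"
      using lin_dep_iff_in_span[OF sub(3) IH(2) sub(2)] by simp
    then show ?thesis
      using False piv IH new(1) span_insert_cong[OF sub(3,1,2)] by auto
  qed
qed

lemma (in vectorspace) dim_eq_card_pivots:
  fixes v :: "'i::linorder \<Rightarrow> 'c"
  assumes "finite T" "v ` T \<subseteq> carrier V" "span (v ` T) = carrier V"
  shows "dim = card (pivots v T)"
proof -
  have "pivots v T \<subseteq> T" by (auto simp: pivots_def)
  moreover from this have "basis (v ` pivots v T)"
    using pivots_basis[OF assms(1,2)] assms unfolding basis_def by auto
  ultimately have "dim = card (v ` pivots v T)"
    using assms(1) by (intro dim_basis) (auto intro: finite_subset)
  then show ?thesis using pivots_basis[OF assms(1,2)] by (simp add: card_image)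
qed


section \<open>Homogeneous components\<close>

lemma (in module) submodule_finsum:
  assumes "LinearCombinations.submodule R N M" "\<And>x. x \<in> A \<Longrightarrow> f x \<in> N"
  shows "finsum M f A \<in> N"
proof -
  interpret N: LinearCombinations.submodule R N M by fact
  show ?thesis using assms(2)
  proof (induction A rule: infinite_finite_induct)
    case (insert x A)
    then have "finsum M f (insert x A) = f x \<oplus>\<^bsub>M\<^esub> finsum M f A"
      using N.subset by (intro M.finsum_insert) auto
    with insert show ?case by simp
  qed (auto simp: M.finsum_infinite)
qed

context graded_poly_module
begin

lemma G_carrier: "x \<in> G j \<Longrightarrow> x \<in> carrier M"
  using subgroup.subset[OF component_subgroup] by auto

lemma G_add: "x \<in> G j \<Longrightarrow> y \<in> G j \<Longrightarrow> x \<oplus>\<^bsub>M\<^esub> y \<in> G j"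
  using subgroup.m_closed[OF component_subgroup] by auto

lemma G_zero: "\<zero>\<^bsub>M\<^esub> \<in> G j"
  using subgroup.one_closed[OF component_subgroup] by auto

lemma poly_ring_simps:
  "add (poly_ring n) = ((+) :: _ \<Rightarrow> _ \<Rightarrow> (nat \<Rightarrow>\<^sub>0 nat) \<Rightarrow>\<^sub>0 'f)"
  "mult (poly_ring n) = ((*) :: _ \<Rightarrow> _ \<Rightarrow> (nat \<Rightarrow>\<^sub>0 nat) \<Rightarrow>\<^sub>0 'f)"
  "monoid.one (poly_ring n) = (1 :: (nat \<Rightarrow>\<^sub>0 nat) \<Rightarrow>\<^sub>0 'f)"
  "ring.zero (poly_ring n) = (0 :: (nat \<Rightarrow>\<^sub>0 nat) \<Rightarrow>\<^sub>0 'f)"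
  by (simp_all add: poly_ring_def)

lemma single_carrier:
  "a \<in> exponents {1..n} \<Longrightarrow> Poly_Mapping.single a (c :: 'f) \<in> carrier (poly_ring n)"
  by (simp add: poly_ring_def exponents_def)

lemma single_smult_G:
  fixes c :: 'f
  assumes "a \<in> exponents {1..n}" "x \<in> G j"
  shows "Poly_Mapping.single a c \<odot>\<^bsub>M\<^esub> x \<in> G (int (weight d {1..n} a) + j)"
proof (rule smult_homogeneous)
  show "Poly_Mapping.single a c \<in> poly_homogeneous n d (int (weight d {1..n} a))"
    using single_carrier[OF assms(1), of c]
    by (auto simp: poly_homogeneous_def weighted_degree_def weight_def split: if_splits)
qed fact

lemma single_smult_single:
  fixes c c' :: 'f
  assumes "a \<in> exponents {1..n}" "b \<in> exponents {1..n}" "x \<in> carrier M"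
  shows "Poly_Mapping.single a c \<odot>\<^bsub>M\<^esub> (Poly_Mapping.single b c' \<odot>\<^bsub>M\<^esub> x) =
    Poly_Mapping.single (a + b) (c * c') \<odot>\<^bsub>M\<^esub> x"
  using smult_assoc1[OF single_carrier[OF assms(1), of c] single_carrier[OF assms(2), of c'] assms(3)]
  by (simp add: poly_ring_simps mult_single)

text \<open>A polynomial is built by adding one term at a time. The set \<open>N\<close> is only
  assumed to be additively closed, so that the lemma can serve in proving that \<open>N\<close> is a
  submodule.\<close>

lemma smult_closed_by_singles:
  assumes p: "p \<in> carrier (poly_ring n)" and x: "x \<in> carrier M"
    and N: "N \<subseteq> carrier M" "\<zero>\<^bsub>M\<^esub> \<in> N" "\<And>y z. y \<in> N \<Longrightarrow> z \<in> N \<Longrightarrow> y \<oplus>\<^bsub>M\<^esub> z \<in> N"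
    and single: "\<And>a c. a \<in> exponents {1..n} \<Longrightarrow> Poly_Mapping.single a (c :: 'f) \<odot>\<^bsub>M\<^esub> x \<in> N"
  shows "p \<odot>\<^bsub>M\<^esub> x \<in> N"
  using p
proof (induction p rule: Poly_Mapping.update_induct)
  case const
  then show ?case using smult_l_null[OF x] N(2) by (simp add: poly_ring_simps)
next
  case (update q a c)
  have upd: "Poly_Mapping.update a c q = q + Poly_Mapping.single a c"
    using update.hyps
    by (intro poly_mapping_eqI) (auto simp: lookup_update lookup_add lookup_single in_keys_iff when_def)
  have keys: "Poly_Mapping.keys (Poly_Mapping.update a c q) = insert a (Poly_Mapping.keys q)"
    using update.hyps by (auto simp: in_keys_iff lookup_update split: if_splits)
  from update.prems have q: "q \<in> carrier (poly_ring n)" and a: "a \<in> exponents {1..n}"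
    by (simp_all add: poly_ring_def exponents_def keys)
  have "Poly_Mapping.update a c q \<odot>\<^bsub>M\<^esub> x = q \<odot>\<^bsub>M\<^esub> x \<oplus>\<^bsub>M\<^esub> Poly_Mapping.single a c \<odot>\<^bsub>M\<^esub> x"
    using smult_l_distr[OF q single_carrier[OF a] x] by (simp add: upd poly_ring_simps)
  then show ?case using N(3)[OF update.IH[OF q] single[OF a]] by simp
qed

section \<open>Projections onto the homogeneous components\<close>

definition component :: "'m \<Rightarrow> int \<Rightarrow> 'm" where
  "component x = (THE c. (\<forall>j. c j \<in> G j) \<and> finite {j. c j \<noteq> \<zero>\<^bsub>M\<^esub>} \<and>
    x = finsum M c {j. c j \<noteq> \<zero>\<^bsub>M\<^esub>})"

lemma component:
  assumes "x \<in> carrier M"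
  shows component_G: "component x j \<in> G j"
    and finite_component: "finite {j. component x j \<noteq> \<zero>\<^bsub>M\<^esub>}"
    and finsum_component: "finsum M (component x) {j. component x j \<noteq> \<zero>\<^bsub>M\<^esub>} = x"
  using theI'[OF direct_decomposition[OF assms]] unfolding component_def by auto

text \<open>Any finite \<open>F\<close> containing the support may be used, since zero terms do not
  alter the sum; for \<open>component_add\<close> it is a union of two supports.\<close>

lemma component_eqI:
  assumes c: "\<And>j. c j \<in> G j" and F: "finite F" "\<And>j. j \<notin> F \<Longrightarrow> c j = \<zero>\<^bsub>M\<^esub>"
    and x: "x = finsum M c F"
  shows "component x = c"
proof -
  have cM: "c \<in> UNIV \<rightarrow> carrier M" using c G_carrier by auto
  have supp: "{j. c j \<noteq> \<zero>\<^bsub>M\<^esub>} \<subseteq> F" using F(2) by auto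
  then have fin: "finite {j. c j \<noteq> \<zero>\<^bsub>M\<^esub>}" using F(1) finite_subset by blast
  have "finsum M c {j. c j \<noteq> \<zero>\<^bsub>M\<^esub>} = finsum M c F"
    by (rule M.add.finprod_mono_neutral_cong_left) (use F supp cM in auto)
  moreover have "x \<in> carrier M" unfolding x using cM by (intro M.finsum_closed) auto
  ultimately show ?thesis
    unfolding component_def using c fin x
    by (intro the1_equality direct_decomposition) auto
qed

lemma component_homogeneous:
  assumes "x \<in> G k"
  shows "component x = (\<lambda>j. if j = k then x else \<zero>\<^bsub>M\<^esub>)"
proof (rule component_eqI[where F = "{k}"])
  show "x = finsum M (\<lambda>j. if j = k then x else \<zero>\<^bsub>M\<^esub>) {k}"
    using G_carrier[OF assms] M.finsum_insert[of "{}" k "\<lambda>j. if j = k then x else \<zero>\<^bsub>M\<^esub>"] by simp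
qed (use assms G_zero in auto)

lemma component_add:
  assumes "x \<in> carrier M" "y \<in> carrier M"
  shows "component (x \<oplus>\<^bsub>M\<^esub> y) = (\<lambda>j. component x j \<oplus>\<^bsub>M\<^esub> component y j)"
proof (rule component_eqI)
  let ?A = "{j. component x j \<noteq> \<zero>\<^bsub>M\<^esub>}" and ?B = "{j. component y j \<noteq> \<zero>\<^bsub>M\<^esub>}"
  have car: "component x j \<in> carrier M" "component y j \<in> carrier M" for j
    using component_G assms G_carrier by auto
  have fin: "finite ?A" "finite ?B" using finite_component assms by auto
  then show "finite (?A \<union> ?B)" by simp
  have "finsum M (component x) ?A = finsum M (component x) (?A \<union> ?B)"
    "finsum M (component y) ?B = finsum M (component y) (?A \<union> ?B)"
    by (rule M.add.finprod_mono_neutral_cong_left; use fin car in auto)+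
  then show "x \<oplus>\<^bsub>M\<^esub> y = finsum M (\<lambda>j. component x j \<oplus>\<^bsub>M\<^esub> component y j) (?A \<union> ?B)"
    using finsum_component[OF assms(1)] finsum_component[OF assms(2)] car
    by (subst M.finsum_addf) auto
qed (use assms component_G G_add in auto)

text \<open>Subspace candidates \<open>H j\<close> in the single degrees are assembled into a
  submodule, so that an inclusion of all of \<open>M\<close> can be checked on generators. For
  scalars, a term moves each \<open>component x j\<close> into one set of the family, and
  \<open>x\<close> is the sum of its components.\<close>

lemma homogeneous_submodule:
  assumes H: "\<And>j. H j \<subseteq> G j" "\<And>j. \<zero>\<^bsub>M\<^esub> \<in> H j"
    "\<And>j x y. x \<in> H j \<Longrightarrow> y \<in> H j \<Longrightarrow> x \<oplus>\<^bsub>M\<^esub> y \<in> H j"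
    "\<And>a c j x. a \<in> exponents {1..n} \<Longrightarrow> x \<in> H j \<Longrightarrow>
      Poly_Mapping.single a (c :: 'f) \<odot>\<^bsub>M\<^esub> x \<in> H (int (weight d {1..n} a) + j)"
  shows "LinearCombinations.submodule (poly_ring n) {x \<in> carrier M. \<forall>j. component x j \<in> H j} M"
    (is "LinearCombinations.submodule _ ?N _")
proof
  have HN: "x \<in> ?N" if "x \<in> H k" for x k
    using that H(1)[of k] H(2) G_carrier component_homogeneous[of x k] by auto
  have add: "x \<oplus>\<^bsub>M\<^esub> y \<in> ?N" if "x \<in> ?N" "y \<in> ?N" for x y
    using that H(3) by (auto simp: component_add)
  have zero: "\<zero>\<^bsub>M\<^esub> \<in> ?N" using HN H(2) by blast
  have sum: "finsum M f A \<in> ?N" if "\<And>x. x \<in> A \<Longrightarrow> f x \<in> ?N" for f and A :: "int set"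
    using that
  proof (induction A rule: infinite_finite_induct)
    case (insert x A)
    then have "finsum M f (insert x A) = f x \<oplus>\<^bsub>M\<^esub> finsum M f A"
      by (intro M.finsum_insert) auto
    with insert add show ?case by simp
  qed (use zero in \<open>auto simp: M.finsum_infinite\<close>)
  fix p :: "(nat \<Rightarrow>\<^sub>0 nat) \<Rightarrow>\<^sub>0 'f" and x
  assume p: "p \<in> carrier (poly_ring n)" and x: "x \<in> ?N"
  show "p \<odot>\<^bsub>M\<^esub> x \<in> ?N"
  proof (rule smult_closed_by_singles[OF p])
    fix a and c :: 'f assume a: "a \<in> exponents {1..n}"
    let ?s = "Poly_Mapping.single a c" and ?A = "{j. component x j \<noteq> \<zero>\<^bsub>M\<^esub>}"
    have xM: "x \<in> carrier M" using x by simp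
    have "?s \<odot>\<^bsub>M\<^esub> finsum M (component x) ?A = finsum M (\<lambda>j. ?s \<odot>\<^bsub>M\<^esub> component x j) ?A"
      using finite_component[OF xM] single_carrier[OF a] component_G[OF xM] G_carrier
      by (intro finsum_smult_ldistr) auto
    moreover have "?s \<odot>\<^bsub>M\<^esub> component x j \<in> ?N" for j
      using x by (intro HN[OF H(4)[OF a]]) auto
    ultimately show "?s \<odot>\<^bsub>M\<^esub> x \<in> ?N"
      using sum[of ?A "\<lambda>j. ?s \<odot>\<^bsub>M\<^esub> component x j"] finsum_component[OF xM] by simp
  qed (use x zero add in auto)
qed (use assms in \<open>auto simp: component_add component_homogeneous[OF G_zero[of 0]] module_axioms cong: if_cong\<close>)

text \<open>The nonzero components of the elements of a finite generating set are finitely many, and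
  they generate because each element is the sum of its components.\<close>

lemma homogeneous_generators:
  assumes "finitely_generated (poly_ring n) M"
  obtains r :: nat and g :: "nat \<Rightarrow> 'm" and e :: "nat \<Rightarrow> int"
  where "\<And>i. i < r \<Longrightarrow> g i \<in> G (e i)" "span (g ` {..<r}) = carrier M"
proof -
  obtain S where S: "finite S" "S \<subseteq> carrier M" "span S = carrier M"
    using assms unfolding finitely_generated_def by blast
  \<comment> \<open>Each component is paired with its degree, from which \<open>e\<close> is read
    off.\<close>
  define P where "P = (\<Union>s\<in>S. (\<lambda>j. (j, component s j)) ` {j. component s j \<noteq> \<zero>\<^bsub>M\<^esub>})"
  have "finite P" unfolding P_def using S finite_component by auto
  then obtain ps where ps: "set ps = P" using finite_list by blast
  let ?g = "\<lambda>i. snd (ps ! i)" and ?e = "\<lambda>i. fst (ps ! i)"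
  have "\<And>j y. (j, y) \<in> P \<Longrightarrow> y \<in> G j"
    unfolding P_def using component_G S(2) by auto
  then have hom: "?g i \<in> G (?e i)" if "i < length ps" for i
    using that ps nth_mem by (metis prod.collapse)
  have im: "?g ` {..<length ps} = snd ` P"
    unfolding ps[symmetric] set_conv_nth by auto
  have gM: "snd ` P \<subseteq> carrier M" unfolding im[symmetric] using hom G_carrier by auto
  have "span S \<subseteq> span (snd ` P)"
  proof (rule span_is_subset)
    show sm: "LinearCombinations.submodule (poly_ring n) (span (snd ` P)) M"
      by (rule span_is_submodule[OF gM])
    show "S \<subseteq> span (snd ` P)"
    proof
      fix s assume s: "s \<in> S"
      then have "finsum M (component s) {j. component s j \<noteq> \<zero>\<^bsub>M\<^esub>} \<in> span (snd ` P)"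
        by (intro submodule_finsum[OF sm] subsetD[OF in_own_span[OF gM]]) (force simp: P_def)
      with s S(2) show "s \<in> span (snd ` P)" using finsum_component by auto
    qed
  qed
  with S(3) span_is_subset2[OF gM] have "span (?g ` {..<length ps}) = carrier M"
    unfolding im by auto
  with hom show thesis by (rule that)
qed

end


section \<open>Standard monomials\<close>

text \<open>The degrees \<open>e i\<close> are part of the data: a generator may be zero, and zero
  lies in every component.\<close>

locale graded_generators = graded_poly_module n M d G
  for n :: nat and M :: "((nat \<Rightarrow>\<^sub>0 nat) \<Rightarrow>\<^sub>0 'f::field, 'm) module" and d G +
  fixes r :: nat and g :: "nat \<Rightarrow> 'm" and e :: "nat \<Rightarrow> int"
  assumes degree_pos: "\<And>i. i \<in> {1..n} \<Longrightarrow> d i \<ge> 1"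
    and generator_homogeneous: "\<And>i. i < r \<Longrightarrow> g i \<in> G (e i)"
    and generators: "span (g ` {..<r}) = carrier M"
begin

abbreviation E :: "(nat \<Rightarrow>\<^sub>0 nat) set" where "E \<equiv> exponents {1..n}"

abbreviation wt :: "(nat \<Rightarrow>\<^sub>0 nat) \<Rightarrow> int" where "wt a \<equiv> int (weight d {1..n} a)"

abbreviation component_span :: "int \<Rightarrow> 'm set \<Rightarrow> 'm set" where
  "component_span j \<equiv> LinearCombinations.module.span (class_ring :: 'f ring) (component_space M (G j))"

text \<open>Pairs instead of elements of \<open>M\<close>: distinct pairs may give the same element,
  and the order lives on the pairs.\<close>

definition monomials :: "int \<Rightarrow> ((nat \<Rightarrow>\<^sub>0 nat) \<times> nat) set" where
  "monomials j = {(a, i). a \<in> E \<and> i < r \<and> wt a + e i = j}"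

definition monomial :: "(nat \<Rightarrow>\<^sub>0 nat) \<times> nat \<Rightarrow> 'm" where
  "monomial t = Poly_Mapping.single (fst t) 1 \<odot>\<^bsub>M\<^esub> g (snd t)"

text \<open>Pairs are compared lexicographically, exponent first. These are the standard monomials
  of the module of relations among the generators: those that are not the leading monomial of a
  homogeneous relation.\<close>

definition standard :: "nat \<Rightarrow> (nat \<Rightarrow>\<^sub>0 nat) set" where
  "standard i = {a \<in> E. monomial (a, i) \<notin>
    component_span (wt a + e i) (monomial ` {t \<in> monomials (wt a + e i). t < (a, i)})}"

section \<open>Linear spans inside one homogeneous component\<close>

lemma component_space_simps:
  "carrier (component_space M (G j)) = G j"
  "add (component_space M (G j)) = add M"
  "ring.zero (component_space M (G j)) = ring.zero M"
  "c \<odot>\<^bsub>component_space M (G j)\<^esub> x = Poly_Mapping.single 0 c \<odot>\<^bsub>M\<^esub> x"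
  by (simp_all add: component_space_def)

lemma component_module: "module (class_ring :: 'f ring) (component_space M (G j))"
  using vectorspace_component vectorspace.axioms(1) by blast

lemma component_span_submodule:
  "A \<subseteq> G j \<Longrightarrow>
    LinearCombinations.submodule (class_ring :: 'f ring) (component_span j A) (component_space M (G j))"
  using LinearCombinations.module.span_is_submodule[OF component_module, of A j]
  by (simp add: component_space_simps)

lemma component_span_own: "A \<subseteq> G j \<Longrightarrow> A \<subseteq> component_span j A"
  using LinearCombinations.module.in_own_span[OF component_module, of A j]
  by (simp add: component_space_simps)

lemma component_span_G: "A \<subseteq> G j \<Longrightarrow> component_span j A \<subseteq> G j"
  using LinearCombinations.module.span_is_subset2[OF component_module, of A j]
  by (simp add: component_space_simps)

lemma component_span_closed:
  assumes "A \<subseteq> G j"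
  shows "\<zero>\<^bsub>M\<^esub> \<in> component_span j A"
    and "x \<in> component_span j A \<Longrightarrow> y \<in> component_span j A \<Longrightarrow> x \<oplus>\<^bsub>M\<^esub> y \<in> component_span j A"
    and "x \<in> component_span j A \<Longrightarrow> Poly_Mapping.single 0 c \<odot>\<^bsub>M\<^esub> x \<in> component_span j A"
  using component_span_submodule[OF assms]
  unfolding LinearCombinations.submodule_def component_space_simps by auto

lemma zero_in_E: "0 \<in> E" by (simp add: exponents_def)

text \<open>Multiplication by a term is linear over the field, so it is enough to know the images of
  a spanning set: the preimage \<open>?N\<close> of the target span is a subspace containing
  \<open>A\<close>.\<close>

lemma single_smult_component_span:
  fixes c :: 'f
  assumes a: "a \<in> E" and A: "A \<subseteq> G j" and B: "B \<subseteq> G (wt a + j)"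
    and AB: "\<And>y. y \<in> A \<Longrightarrow> Poly_Mapping.single a 1 \<odot>\<^bsub>M\<^esub> y \<in> component_span (wt a + j) B"
    and x: "x \<in> component_span j A"
  shows "Poly_Mapping.single a c \<odot>\<^bsub>M\<^esub> x \<in> component_span (wt a + j) B"
proof -
  let ?S = "component_span (wt a + j) B"
  let ?N = "{y \<in> G j. Poly_Mapping.single a c \<odot>\<^bsub>M\<^esub> y \<in> ?S}"
  have comm: "Poly_Mapping.single a c \<odot>\<^bsub>M\<^esub> (Poly_Mapping.single 0 c' \<odot>\<^bsub>M\<^esub> y) =
      Poly_Mapping.single 0 c' \<odot>\<^bsub>M\<^esub> (Poly_Mapping.single a c \<odot>\<^bsub>M\<^esub> y)" if "y \<in> G j" for c' :: 'f and y
    using that a zero_in_E by (simp add: single_smult_single G_carrier mult.commute)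
  have "LinearCombinations.submodule (class_ring :: 'f ring) ?N (component_space M (G j))"
    unfolding LinearCombinations.submodule_def component_space_simps
  proof (intro conjI allI impI)
    fix x y assume xy: "x \<in> ?N" "y \<in> ?N"
    then have "x \<in> carrier M" "y \<in> carrier M" using G_carrier by auto
    with xy show "x \<oplus>\<^bsub>M\<^esub> y \<in> ?N"
      using component_span_closed(2)[OF B] single_carrier[OF a]
      by (simp add: G_add smult_r_distr)
  next
    show "\<zero>\<^bsub>M\<^esub> \<in> ?N"
      using component_span_closed(1)[OF B] single_carrier[OF a] by (simp add: G_zero)
  next
    fix c' :: 'f and y assume y: "y \<in> ?N"
    then show "Poly_Mapping.single 0 c' \<odot>\<^bsub>M\<^esub> y \<in> ?N"
      using comm[of y c'] component_span_closed(3)[OF B] single_smult_G[OF zero_in_E, of y j c']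
      by (simp add: weight_def)
  qed (use component_module in auto)
  moreover have "A \<subseteq> ?N"
  proof
    fix y assume y: "y \<in> A"
    then have "Poly_Mapping.single a c \<odot>\<^bsub>M\<^esub> y = Poly_Mapping.single 0 c \<odot>\<^bsub>M\<^esub> (Poly_Mapping.single a 1 \<odot>\<^bsub>M\<^esub> y)"
      using A a zero_in_E by (subst single_smult_single) (auto simp: G_carrier)
    then show "y \<in> ?N" using component_span_closed(3)[OF B AB[OF y]] A y by auto
  qed
  ultimately have "component_span j A \<subseteq> ?N"
    by (intro LinearCombinations.module.span_is_subset[OF component_module])
  with x show ?thesis by auto
qed

lemma monomial_G: "t \<in> monomials j \<Longrightarrow> monomial t \<in> G j"
  using single_smult_G[OF _ generator_homogeneous] by (auto simp: monomials_def monomial_def)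

lemma single_smult_monomial:
  assumes "c \<in> E" "a \<in> E" "i < r"
  shows "Poly_Mapping.single c 1 \<odot>\<^bsub>M\<^esub> monomial (a, i) = monomial (a + c, i)"
  using assms generator_homogeneous[OF assms(3)]
  by (simp add: monomial_def single_smult_single G_carrier add.commute)

text \<open>The elements with all components in these spans form a submodule containing every
  \<open>g i\<close>, hence all of \<open>M\<close>; and an element of \<open>G j\<close> is its own
  component of degree \<open>j\<close>.\<close>

lemma monomials_span: "component_span j (monomial ` monomials j) = G j"
proof -
  let ?H = "\<lambda>j. component_span j (monomial ` monomials j)"
  have mG: "monomial ` monomials j \<subseteq> G j" for j using monomial_G by auto
  have "Poly_Mapping.single a c \<odot>\<^bsub>M\<^esub> x \<in> ?H (wt a + j)"
    if a: "a \<in> E" and x: "x \<in> ?H j" for a j x and c :: 'f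
  proof (rule single_smult_component_span[OF a mG mG _ x])
    fix y assume "y \<in> monomial ` monomials j"
    then obtain b i where b: "b \<in> E" "i < r" "wt b + e i = j" "y = monomial (b, i)"
      by (auto simp: monomials_def)
    then have "(b + a, i) \<in> monomials (wt a + j)"
      using a by (auto simp: monomials_def exponents_plus_iff weight_add)
    then show "Poly_Mapping.single a 1 \<odot>\<^bsub>M\<^esub> y \<in> ?H (wt a + j)"
      using component_span_own[OF mG] single_smult_monomial[OF a b(1,2)] b(4) by auto
  qed
  then have sm: "LinearCombinations.submodule (poly_ring n) {x \<in> carrier M. \<forall>j. component x j \<in> ?H j} M"
    by (intro homogeneous_submodule component_span_G component_span_closed mG)
  have "g ` {..<r} \<subseteq> {x \<in> carrier M. \<forall>j. component x j \<in> ?H j}"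
  proof (clarsimp, intro conjI allI)
    fix i j assume i: "i < r"
    show gM: "g i \<in> carrier M" using generator_homogeneous[OF i] G_carrier by auto
    have "(0, i) \<in> monomials (e i)" using i zero_in_E by (simp add: monomials_def weight_def)
    moreover have "monomial (0, i) = g i"
      using smult_one[OF gM] by (simp add: monomial_def poly_ring_simps)
    ultimately have "g i \<in> ?H (e i)" using component_span_own[OF mG] by force
    then show "component (g i) j \<in> ?H j"
      using component_homogeneous[OF generator_homogeneous[OF i]] component_span_closed(1)[OF mG] by auto
  qed
  from span_is_subset[OF this sm]
  have "carrier M \<subseteq> {x \<in> carrier M. \<forall>j. component x j \<in> ?H j}"
    unfolding generators .
  then have "x \<in> ?H j" if "x \<in> G j" for x
    using component_homogeneous[OF that] G_carrier[OF that] by (auto dest!: spec[of _ j] subsetD)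
  with component_span_G[OF mG] show ?thesis by blast
qed

lemma finite_exponents_wt: "finite {a \<in> E. wt a = k}"
  by (rule finite_subset[OF _ finite_exponents_weight[of "{1..n}" d "nat k"]])
    (use degree_pos in auto)

lemma finite_monomials: "finite (monomials j)"
proof (rule finite_subset)
  show "monomials j \<subseteq> (\<Union>i<r. {a \<in> E. wt a = j - e i} \<times> {i})"
    by (auto simp: monomials_def)
qed (use finite_exponents_wt in auto)

text \<open>If \<open>(a, i)\<close> depends on smaller pairs of its degree, multiplication by the
  monomial with exponent \<open>c\<close> makes \<open>(a + c, i)\<close> depend on smaller pairs of
  the new degree.\<close>

lemma lower_set_standard:
  assumes i: "i < r"
  shows "lower_set (standard i)"
  unfolding lower_set_def
proof (intro allI impI, rule ccontr)
  fix a c assume ac: "a + c \<in> standard i" and "a \<notin> standard i"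
  let ?L = "\<lambda>a. monomial ` {t \<in> monomials (wt a + e i). t < (a, i)}"
  from ac have E: "a \<in> E" "c \<in> E" by (auto simp: standard_def exponents_plus_iff)
  have deg: "wt (a + c) + e i = wt c + (wt a + e i)" by (simp add: weight_add)
  have L: "?L a \<subseteq> G (wt a + e i)" for a using monomial_G by auto
  have L': "?L (a + c) \<subseteq> G (wt c + (wt a + e i))" using L[of "a + c"] unfolding deg .
  have step: "Poly_Mapping.single c 1 \<odot>\<^bsub>M\<^esub> y \<in> component_span (wt c + (wt a + e i)) (?L (a + c))"
    if "y \<in> ?L a" for y
  proof -
    from that obtain b k where b: "b \<in> E" "k < r" "wt b + e k = wt a + e i" "(b, k) < (a, i)"
      "y = monomial (b, k)" by (auto simp: monomials_def)
    \<comment> \<open>Here the compatibility of the order with addition is used: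
      \<open>(b + c, k) < (a + c, i)\<close>.\<close>
    then have "(b + c, k) \<in> {t \<in> monomials (wt (a + c) + e i). t < (a + c, i)}"
      using E by (auto simp: monomials_def exponents_plus_iff weight_add)
    then show ?thesis
      using component_span_own[OF L'] single_smult_monomial[OF E(2) b(1,2)] b(5)
      unfolding deg by auto
  qed
  have "monomial (a, i) \<in> component_span (wt a + e i) (?L a)"
    using E \<open>a \<notin> standard i\<close> by (auto simp: standard_def)
  from single_smult_component_span[OF E(2) L L' step this]
  have "Poly_Mapping.single c 1 \<odot>\<^bsub>M\<^esub> monomial (a, i) \<in>
    component_span (wt c + (wt a + e i)) (?L (a + c))" .
  with ac show False
    using single_smult_monomial[OF E(2,1) i] unfolding standard_def deg[symmetric] by simp
qed

text \<open>The standard pairs of degree \<open>j\<close> are the pivots of the spanning family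
  \<open>monomial\<close> on \<open>monomials j\<close>; they are counted by generator
  index.\<close>

lemma dim_component:
  "vectorspace.dim (class_ring :: 'f ring) (component_space M (G j)) =
    (\<Sum>i<r. card {a \<in> standard i. wt a = j - e i})"
proof -
  interpret V: vectorspace "class_ring :: 'f ring" "component_space M (G j)"
    by (rule vectorspace_component)
  have "V.dim = card (V.pivots monomial (monomials j))"
    using finite_monomials monomials_span monomial_G
    by (intro V.dim_eq_card_pivots) (auto simp: component_space_simps)
  also have "V.pivots monomial (monomials j) =
      prod.swap ` (SIGMA i:{..<r}. {a \<in> standard i. wt a = j - e i})"
    by (auto simp: V.pivots_def standard_def monomials_def image_iff)
  also have "card \<dots> = (\<Sum>i<r. card {a \<in> standard i. wt a = j - e i})"
  proof -
    have "finite {a \<in> standard i. wt a = j - e i}" for i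
      by (rule finite_subset[OF _ finite_exponents_wt[of "j - e i"]]) (auto simp: standard_def)
    then show ?thesis by (simp add: card_image card_SigmaI)
  qed
  finally show ?thesis .
qed

text \<open>The product of exponent \<open>a\<close> with \<open>g i\<close> has degree
  \<open>wt a + e i\<close>, whence the shift by \<open>e i\<close>.\<close>

lemma hilbert_series_standard:
  "hilbert_series M G = (\<Sum>i<r. fls_X_intpow (e i) * exponent_series d {1..n} (standard i))"
    (is "_ = ?f")
proof -
  have "int (vectorspace.dim (class_ring :: 'f ring) (component_space M (G j))) = fls_nth ?f j" for j
    by (simp add: dim_component fls_nth_sum fls_X_intpow_times_conv_shift exponent_series_nth)
  \<comment> \<open>\<open>Abs_fls\<close> is meaningful only for functions that vanish in all
    sufficiently negative degrees; the dimensions do, being the coefficients of the Laurent series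
    \<open>?f\<close>.\<close>
  then show ?thesis unfolding hilbert_series_def by (simp add: fls_nth_inverse)
qed

lemma geometric_combination_hilbert_series: "geometric_combination d {1..n} (hilbert_series M G)"
  unfolding hilbert_series_standard
  by (intro geometric_combination_sum geometric_combination_shift lower_set_geometric_combination
      lower_set_standard) (use degree_pos in \<open>auto simp: standard_def\<close>)

end

theorem theorem2p1:
  fixes n :: nat and d :: "nat \<Rightarrow> nat"
    and M :: "((nat \<Rightarrow>\<^sub>0 nat) \<Rightarrow>\<^sub>0 'f::field, 'm) module" and G :: "int \<Rightarrow> 'm set"
  assumes "\<And>i. i \<in> {1..n} \<Longrightarrow> d i \<ge> 1"
    and "graded_poly_module n M d G"
    and "finitely_generated (poly_ring n) M"
  shows "\<exists>Q :: nat set \<Rightarrow> int fls.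
    (\<forall>I \<subseteq> {1..n}. laurent_polynomial (Q I) \<and> nonnegative (Q I)) \<and>
    hilbert_series M G = (\<Sum>I \<in> Pow {1..n}. Q I * (\<Prod>i\<in>I. geometric_fls (d i)))"
proof -
  interpret graded_poly_module n M d G by fact
  obtain r :: nat and g e where "\<And>i. i < r \<Longrightarrow> g i \<in> G (e i)" "span (g ` {..<r}) = carrier M"
    using homogeneous_generators[OF assms(3)] by blast
  then interpret graded_generators n M d G r g e
    by unfold_locales (use assms(1) in auto)
  show ?thesis
    using geometric_combination_hilbert_series unfolding geometric_combination_def .
qed

end
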